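(* Let $C$ be an $n\times n$ real symmetric positive-semidefinite matrix with greatest eigenvalue $\lambda_{\max}$, let $0<s<n$ be an integer with $\operatorname{rank}(C)\ge s$, and let $C=\Phi\Lambda\Phi^\top$ be a real Schur decomposition of $C$. Let $A:=\Phi(I_n-\frac{1}{\lambda_{\max}}\Lambda)^{1/2}$ and $B:=\frac{1}{\sqrt{\lambda_{\max}}}\Lambda^{1/2}$ (i.e. $\text{D-Opt}(A,B,n-s)=\mathcal{D}(\mathrm{MESP}(C,s);\Phi)$). Then the $\mathcal{D}$-induced natural bound equals the NLP-Id bound for $\mathrm{MESP}(C,s)$; that is, $$\mathfrak{z}_{\mathcal N}(A,B,n-s)+s\log\lambda_{\max}=z_{\text{NLP-Id}}(C,s).$$
   Context: $\operatorname{ldet}$ is the natural logarithm of the determinant, with value $-\infty$ on singular positive-semidefinite matrices. A real Schur decomposition of a symmetric $C$ is $C=\Phi\Lambda\Phi^\top$ with $\Phi$ orthogonal and $\Lambda$ diagonal. $\mathbf{e}$ is the all-ones vector. Natural bound: $\mathfrak{z}_{\mathcal N}(A,B,t):=\max\{\operatorname{ldet}(A^\top\operatorname{Diag}(x)A+B^\top B):\ \mathbf{e}^\top x=t,\ x\in[0,1]^n\}$. NLP-Id bound: $z_{\text{NLP-Id}}(C,s):=\max\{\operatorname{ldet}(I_n+\operatorname{Diag}(x)^{1/2}(\tfrac{1}{\lambda_{\max}}C-I_n)\operatorname{Diag}(x)^{1/2})+s\log\lambda_{\max}:\ \mathbf{e}^\top x=s,\ x\in[0,1]^n\}$. (This is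 the general NLP bound $\max\{\operatorname{ldet}(\operatorname{Diag}((\gamma d)^x)+\gamma\operatorname{Diag}(x^{p/2})(C-\operatorname{Diag}(d))\operatorname{Diag}(x^{p/2}))-s\log\gamma\}$ with $d=\lambda_{\max}\mathbf{e}$, $\gamma=1/\lambda_{\max}$, $p=\mathbf{e}$, powers taken componentwise.) *)

theory Defs
  imports "HOL-Analysis.Analysis"
begin

definition Diag :: "real^'n \<Rightarrow> real^'n^'n" where
  "Diag x = (\<chi> i j. if i = j then x $ i else 0)"

definition is_diagonal :: "real^'n^'n \<Rightarrow> bool" where
  "is_diagonal D \<longleftrightarrow> (\<forall>i j. i \<noteq> j \<longrightarrow> D $ i $ j = 0)"

definition sym_psd :: "real^'n^'n \<Rightarrow> bool" where
  "sym_psd M \<longleftrightarrow> transpose M = M \<and> (\<forall>v. 0 \<le> v \<bullet> (M *v v))"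

(* The power 1/2 of a diagonal matrix with nonnegative entries.  The lemmas
   sym_psd_diag_sqrt and diag_sqrt_square below show that it is the positive-semidefinite
   square root of such a matrix; it is not meant for other matrices. *)
definition diag_sqrt :: "real^'n^'n \<Rightarrow> real^'n^'n" where
  "diag_sqrt D = Diag (\<chi> i. sqrt (D $ i $ i))"

definition is_eigenvalue :: "real^'n^'n \<Rightarrow> real \<Rightarrow> bool" where
  "is_eigenvalue M l \<longleftrightarrow> (\<exists>v. v \<noteq> 0 \<and> M *v v = l *\<^sub>R v)"

definition lambda_max :: "real^'n^'n \<Rightarrow> real" where
  "lambda_max M = (GREATEST l. is_eigenvalue M l)"

definition real_schur :: "real^'n^'n \<Rightarrow> real^'n^'n \<Rightarrow> real^'n^'n \<Rightarrow> bool" where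
  "real_schur C \<Phi> \<Lambda> \<longleftrightarrow>
     orthogonal_matrix \<Phi> \<and> is_diagonal \<Lambda> \<and> C = \<Phi> ** \<Lambda> ** transpose \<Phi>"

(* Only meaningful on positive-semidefinite matrices, where the determinant is nonnegative
   and vanishes exactly on the singular matrices. *)
definition ldet :: "real^'n^'n \<Rightarrow> ereal" where
  "ldet M = (if det M > 0 then ereal (ln (det M)) else -\<infinity>)"

definition feasible :: "nat \<Rightarrow> (real^'n) set" where
  "feasible t = {x. (\<Sum>i\<in>UNIV. x $ i) = real t \<and> (\<forall>i. 0 \<le> x $ i \<and> x $ i \<le> 1)}"

(* GREATEST denotes a maximum, not a supremum; both maxima below exist for t, s at most n
   (natural_bound_attained, nlp_id_bound_attained). *)
definition natural_bound :: "real^'m^'n \<Rightarrow> real^'m^'k \<Rightarrow> nat \<Rightarrow> ereal" where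
  "natural_bound A B t =
     (GREATEST v. v \<in> (\<lambda>x. ldet (transpose A ** Diag x ** A + transpose B ** B)) ` feasible t)"

definition nlp_id_bound :: "real^'n^'n \<Rightarrow> nat \<Rightarrow> ereal" where
  "nlp_id_bound C s =
     (GREATEST v. v \<in>
        (\<lambda>x. ldet (mat 1 + diag_sqrt (Diag x) ** ((1 / lambda_max C) *\<^sub>R C - mat 1) ** diag_sqrt (Diag x))
             + ereal (real s * ln (lambda_max C))) ` feasible s)"

lemma Diag_mult_vec: "Diag x *v v = (\<chi> i. x $ i * v $ i)"
  by (simp add: Diag_def matrix_vector_mult_def vec_eq_iff mult_delta_left)

lemma sym_psd_diag_sqrt:
  assumes "\<And>i. 0 \<le> D $ i $ i"
  shows "sym_psd (diag_sqrt D)"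
proof -
  have "0 \<le> v \<bullet> (diag_sqrt D *v v)" for v
    unfolding diag_sqrt_def Diag_mult_vec inner_vec_def
  proof (simp, rule sum_nonneg)
    fix i
    have "v $ i * (sqrt (D $ i $ i) * v $ i) = sqrt (D $ i $ i) * (v $ i)\<^sup>2"
      by (simp add: power2_eq_square)
    also have "\<dots> \<ge> 0"
      using assms by simp
    finally show "0 \<le> v $ i * (sqrt (D $ i $ i) * v $ i)" .
  qed
  moreover have "transpose (diag_sqrt D) = diag_sqrt D"
    by (auto simp: diag_sqrt_def Diag_def transpose_def vec_eq_iff)
  ultimately show ?thesis
    by (simp add: sym_psd_def)
qed

lemma diag_sqrt_square:
  assumes "is_diagonal D" "\<And>i. 0 \<le> D $ i $ i"
  shows "diag_sqrt D ** diag_sqrt D = D"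
  using assms
  by (simp add: diag_sqrt_def Diag_def is_diagonal_def matrix_matrix_mult_def vec_eq_iff
      mult_delta_left)

lemma compact_feasible: "compact (feasible t :: (real^'n) set)"
proof -
  have "feasible t = cbox 0 1 \<inter> {x :: real^'n. (\<Sum>i\<in>UNIV. x $ i) = real t}"
    by (auto simp: feasible_def mem_box_cart)
  moreover have "closed {x :: real^'n. (\<Sum>i\<in>UNIV. x $ i) = real t}"
    by (intro closed_Collect_eq continuous_intros)
  ultimately show ?thesis
    by (simp add: compact_Int_closed)
qed

lemma feasible_nonempty:
  assumes "t \<le> CARD('n)"
  shows "(feasible t :: (real^'n) set) \<noteq> {}"
proof -
  have "(\<chi> i. real t / real CARD('n)) \<in> (feasible t :: (real^'n) set)"
    using assms by (simp add: feasible_def)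
  then show ?thesis by blast
qed

lemma ldet_mono_det: "det M \<le> det N \<Longrightarrow> ldet M \<le> ldet N"
  by (auto simp: ldet_def)

lemma ldet_attains_max:
  fixes F :: "real^'n \<Rightarrow> real^'m^'m"
  assumes "\<And>i j. continuous_on UNIV (\<lambda>x. F x $ i $ j)" and "t \<le> CARD('n)"
  shows "\<exists>x\<in>feasible t. \<forall>y\<in>feasible t. ldet (F y) \<le> ldet (F x)"
proof -
  have "continuous_on (feasible t) (\<lambda>x. det (F x))"
    unfolding det_def
    by (intro continuous_intros continuous_on_subset[OF assms(1)] subset_UNIV)
  then have "\<exists>x\<in>feasible t. \<forall>y\<in>feasible t. det (F y) \<le> det (F x)"
    using continuous_attains_sup[OF compact_feasible feasible_nonempty[OF assms(2)]] by blast
  then show ?thesis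
    using ldet_mono_det by blast
qed

lemma continuous_on_matrix_mult_entry:
  fixes F :: "'a::topological_space \<Rightarrow> real^'k^'m" and G :: "'a \<Rightarrow> real^'n^'k"
  assumes "\<And>i j. continuous_on S (\<lambda>x. F x $ i $ j)" "\<And>i j. continuous_on S (\<lambda>x. G x $ i $ j)"
  shows "continuous_on S (\<lambda>x. (F x ** G x) $ i $ j)"
  unfolding matrix_matrix_mult_def vec_lambda_beta
  by (intro continuous_on_sum continuous_on_mult assms)

lemma continuous_on_Diag_entry:
  "continuous_on S (\<lambda>x. Diag x $ i $ j)"
  by (cases "i = j") (simp_all add: Diag_def continuous_on_component)

lemma continuous_on_diag_sqrt_Diag_entry:
  "continuous_on S (\<lambda>x. diag_sqrt (Diag x) $ i $ j)"
  by (cases "i = j")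
    (simp_all add: diag_sqrt_def Diag_def continuous_on_component continuous_on_real_sqrt)

lemma GREATEST_image_attained:
  fixes f :: "'a \<Rightarrow> ereal"
  assumes "x \<in> S" "\<And>y. y \<in> S \<Longrightarrow> f y \<le> f x"
  shows "(GREATEST v. v \<in> f ` S) \<in> f ` S \<and> (\<forall>y\<in>S. f y \<le> (GREATEST v. v \<in> f ` S))"
proof -
  have "(GREATEST v. v \<in> f ` S) = f x"
    using assms by (intro Greatest_equality) auto
  then show ?thesis
    using assms by auto
qed

lemma natural_bound_attained:
  fixes A :: "real^'m^'n" and B :: "real^'m^'k"
  assumes "t \<le> CARD('n)"
  defines "f \<equiv> \<lambda>x. ldet (transpose A ** Diag x ** A + transpose B ** B)"
  shows "natural_bound A B t \<in> f ` feasible t \<and> (\<forall>x\<in>feasible t. f x \<le> natural_bound A B t)"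
proof -
  have "continuous_on UNIV (\<lambda>x. (transpose A ** Diag x ** A + transpose B ** B) $ i $ j)" for i j
    unfolding vector_add_component
    by (intro continuous_on_add continuous_on_matrix_mult_entry continuous_on_Diag_entry
        continuous_on_const)
  from ldet_attains_max[OF this assms(1)] obtain x
    where "x \<in> feasible t" "\<forall>y\<in>feasible t. f y \<le> f x"
    unfolding f_def by blast
  then show ?thesis
    using GREATEST_image_attained[of x "feasible t" f] by (simp add: natural_bound_def f_def)
qed

lemma nlp_id_bound_attained:
  fixes C :: "real^'n^'n"
  assumes "s \<le> CARD('n)"
  defines "f \<equiv> \<lambda>x. ldet (mat 1 + diag_sqrt (Diag x) ** ((1 / lambda_max C) *\<^sub>R C - mat 1)
      ** diag_sqrt (Diag x)) + ereal (real s * ln (lambda_max C))"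
  shows "nlp_id_bound C s \<in> f ` feasible s \<and> (\<forall>x\<in>feasible s. f x \<le> nlp_id_bound C s)"
proof -
  have "continuous_on UNIV (\<lambda>x. (mat 1 + diag_sqrt (Diag x) **
      ((1 / lambda_max C) *\<^sub>R C - mat 1) ** diag_sqrt (Diag x)) $ i $ j)" for i j
    unfolding vector_add_component
    by (intro continuous_on_add continuous_on_matrix_mult_entry continuous_on_const
        continuous_on_diag_sqrt_Diag_entry)
  from ldet_attains_max[OF this assms(1)] obtain x
    where "x \<in> feasible s" "\<forall>y\<in>feasible s. f y \<le> f x"
    unfolding f_def using add_right_mono by blast
  then show ?thesis
    using GREATEST_image_attained[of x "feasible s" f] by (simp add: nlp_id_bound_def f_def)
qed

end

theory Submission
  imports Defs "HOL-Computational_Algebra.Polynomial"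
begin

text \<open>
  Substitute \<open>y = e - x\<close>, which maps the feasible set for \<open>n - s\<close> onto the one for \<open>s\<close>.  With
  \<open>D = (I - \<Lambda>/\<lambda>)^(1/2)\<close>, \<open>S = Diag(y)^(1/2)\<close> and \<open>P = D \<Phi>\<^sup>T S\<close>, the matrix in the natural bound is
  \<open>I - P P\<^sup>T\<close> and the one in the NLP-Id bound is \<open>I - P\<^sup>T P\<close>; these have the same determinant.
\<close>

section \<open>Interchanging the factors in the determinant of \<open>mat 1 - X ** Y\<close>\<close>

lemma matrix_diff_ldistrib:
  fixes A :: "'a::ring_1^'n^'m"
  shows "A ** (B - C) = A ** B - A ** C"
  by (vector matrix_matrix_mult_def sum_subtractf algebra_simps)

lemma matrix_diff_rdistrib:
  fixes A B :: "'a::ring_1^'n^'m"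
  shows "(A - B) ** C = A ** C - B ** C"
  by (vector matrix_matrix_mult_def sum_subtractf algebra_simps)

lemma matrix_mult_minus_left:
  fixes A :: "'a::ring_1^'n^'m"
  shows "(- A) ** B = - (A ** B)"
  by (vector matrix_matrix_mult_def sum_negf)

lemma matrix_mult_minus_right:
  fixes A :: "'a::ring_1^'n^'m"
  shows "A ** (- B) = - (A ** B)"
  by (vector matrix_matrix_mult_def sum_negf)

lemma poly_det: "poly (det M) x = det (\<chi> i j. poly (M $ i $ j) x)"
  by (simp add: det_def poly_sum poly_prod)

text \<open>Take determinants in \<open>(1 - X Y) X = X (1 - Y X)\<close> and cancel
  \<open>det X\<close>. Cancellation needs only an integral domain, so the entries may be
  polynomials, where a nonzero determinant does not give an inverse matrix.\<close>

lemma det_one_minus_mult_commute_nonsingular: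
  fixes X Y :: "'a::idom^'n^'n"
  assumes "det X \<noteq> 0"
  shows "det (mat 1 - X ** Y) = det (mat 1 - Y ** X)"
proof -
  have "(mat 1 - X ** Y) ** X = X ** (mat 1 - Y ** X)"
    by (simp add: matrix_diff_ldistrib matrix_diff_rdistrib matrix_mul_assoc)
  then have "det (mat 1 - X ** Y) * det X = det X * det (mat 1 - Y ** X)"
    by (metis det_mul)
  with assms show ?thesis by simp
qed

text \<open>A kernel vector of \<open>X + mat e\<close> would be an eigenvector of \<open>X\<close>
  for \<open>-e\<close>, which is impossible once \<open>e\<close> exceeds an operator bound of
  \<open>X\<close>.\<close>

lemma exists_shift_nonsingular:
  fixes X :: "real^'n^'n"
  shows "\<exists>e. det (X + mat e) \<noteq> 0"
proof -
  obtain K where K: "\<And>v. norm (X *v v) \<le> norm v * K"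
    using bounded_linear.bounded[OF matrix_vector_mul_bounded_linear[of X]] by blast
  \<comment> \<open>The absolute value keeps \<open>e\<close> positive, so that scaling by
    \<open>e\<close> multiplies norms by \<open>e\<close>; the summand 1 makes \<open>e\<close>
    exceed \<open>K\<close>.\<close>
  define e where "e = \<bar>K\<bar> + 1"
  have mat_e: "mat e *v v = e *\<^sub>R v" for v :: "real^'n"
    by (simp add: vec_eq_iff mat_def matrix_vector_mult_def mult_delta_left)
  have "v = 0" if "(X + mat e) *v v = 0" for v
  proof (rule ccontr)
    assume "v \<noteq> 0"
    have "X *v v = - (e *\<^sub>R v)"
      using that by (simp add: matrix_vector_mult_add_rdistrib mat_e eq_neg_iff_add_eq_0)
    then have "norm v * e \<le> norm v * K"
      using K[of v] by (simp add: e_def mult.commute)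
    with \<open>v \<noteq> 0\<close> show False by (simp add: e_def)
  qed
  then have "det (X + mat e) \<noteq> 0"
    by (metis invertible_det_nz invertible_left_inverse matrix_left_invertible_ker)
  then show ?thesis by blast
qed

text \<open>The nonsingular case is applied over the polynomial ring, to the generic shift of \<open>X\<close>.\<close>

lemma det_one_minus_mult_commute:
  fixes X Y :: "real^'n^'n"
  shows "det (mat 1 - X ** Y) = det (mat 1 - Y ** X)"
proof -
  define M :: "real poly^'n^'n" where "M = (\<chi> i j. [:X $ i $ j, if i = j then 1 else 0:])"
  define N :: "real poly^'n^'n" where "N = (\<chi> i j. [:Y $ i $ j:])"
  have "poly (det M) e = det (X + mat e)" for e
    unfolding poly_det by (rule arg_cong[of _ _ det]) (simp add: M_def vec_eq_iff mat_def)
  \<comment> \<open>A polynomial with a nonzero value is nonzero.\<close>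
  then have "det M \<noteq> 0"
    using exists_shift_nonsingular[of X] by (metis poly_0)
  then have "det (mat 1 - M ** N) = det (mat 1 - N ** M)"
    by (rule det_one_minus_mult_commute_nonsingular)
  \<comment> \<open>Evaluation at 0 undoes the shift and gives back \<open>X\<close> and
    \<open>Y\<close>.\<close>
  then have "poly (det (mat 1 - M ** N)) 0 = poly (det (mat 1 - N ** M)) 0" by simp
  moreover have "(\<chi> i j. poly ((mat 1 - M ** N) $ i $ j) 0) = mat 1 - X ** Y"
    by (simp add: M_def N_def vec_eq_iff mat_def matrix_matrix_mult_def poly_sum
        del: mult_pCons_left mult_pCons_right)
  moreover have "(\<chi> i j. poly ((mat 1 - N ** M) $ i $ j) 0) = mat 1 - Y ** X"
    by (simp add: M_def N_def vec_eq_iff mat_def matrix_matrix_mult_def poly_sum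
        del: mult_pCons_left mult_pCons_right)
  ultimately show ?thesis by (simp add: poly_det)
qed

section \<open>The spectrum read off a real Schur decomposition\<close>

lemma diagonal_eq_Diag: "is_diagonal D \<Longrightarrow> D = Diag (\<chi> i. D $ i $ i)"
  by (simp add: is_diagonal_def Diag_def vec_eq_iff)

lemma diagonal_mult_axis: "is_diagonal D \<Longrightarrow> D *v axis i 1 = D $ i $ i *\<^sub>R axis i (1::real)"
  by (subst diagonal_eq_Diag) (auto simp: Diag_mult_vec vec_eq_iff axis_def)

lemma transpose_diag_sqrt: "transpose (diag_sqrt D) = diag_sqrt D"
  by (auto simp: diag_sqrt_def Diag_def transpose_def vec_eq_iff)

lemma orthogonal_transpose_mult_vec:
  fixes U :: "real^'n^'n"
  assumes "orthogonal_matrix U"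
  shows "transpose U *v (U *v v) = v" "U *v (transpose U *v v) = v"
  using assms by (simp_all add: orthogonal_matrix_def matrix_vector_mul_assoc
      del: transpose_matrix_vector)

lemma real_schur_mult_vec:
  assumes "real_schur C \<Phi> \<Lambda>"
  shows "C *v (\<Phi> *v v) = \<Phi> *v (\<Lambda> *v v)"
  using assms by (simp add: real_schur_def orthogonal_transpose_mult_vec
      del: transpose_matrix_vector flip: matrix_vector_mul_assoc)

text \<open>Multiplication by \<open>transpose \<Phi>\<close> turns eigenvectors of \<open>C\<close>
  into eigenvectors of \<open>\<Lambda>\<close>, and any nonzero coordinate of these reveals the
  eigenvalue. Conversely, the columns of \<open>\<Phi>\<close> are eigenvectors of
  \<open>C\<close>.\<close>

lemma real_schur_eigenvalue_iff:
  assumes "real_schur C \<Phi> \<Lambda>"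
  shows "is_eigenvalue C l \<longleftrightarrow> (\<exists>i. l = \<Lambda> $ i $ i)"
proof
  have orth: "orthogonal_matrix \<Phi>" and diag: "is_diagonal \<Lambda>"
    using assms by (auto simp: real_schur_def)
  {
    assume "is_eigenvalue C l"
    then obtain v where v: "v \<noteq> 0" "C *v v = l *\<^sub>R v"
      by (auto simp: is_eigenvalue_def)
    define w where "w = transpose \<Phi> *v v"
    have vw: "v = \<Phi> *v w"
      by (simp add: w_def orthogonal_transpose_mult_vec[OF orth] del: transpose_matrix_vector)
    with v have "w \<noteq> 0" by auto
    have "\<Phi> *v (\<Lambda> *v w) = \<Phi> *v (l *\<^sub>R w)"
      using v(2) by (simp add: vw real_schur_mult_vec[OF assms] matrix_vector_mult_scaleR)
    then have eq: "\<Lambda> *v w = l *\<^sub>R w"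
      by (metis orthogonal_transpose_mult_vec(1)[OF orth])
    obtain i where i: "w $ i \<noteq> 0" using \<open>w \<noteq> 0\<close> by (auto simp: vec_eq_iff)
    have "\<Lambda> $ i $ i * w $ i = (\<Lambda> *v w) $ i"
      by (subst (2) diagonal_eq_Diag[OF diag]) (simp add: Diag_mult_vec)
    with eq i show "\<exists>i. l = \<Lambda> $ i $ i" by auto
  next
    assume "\<exists>i. l = \<Lambda> $ i $ i"
    then obtain i where i: "l = \<Lambda> $ i $ i" ..
    have "\<Phi> *v axis i 1 \<noteq> 0"
      by (metis orthogonal_transpose_mult_vec(1)[OF orth] matrix_vector_mult_0_right axis_eq_0_iff
          zero_neq_one)
    moreover have "C *v (\<Phi> *v axis i 1) = l *\<^sub>R (\<Phi> *v axis i 1)"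
      by (simp add: real_schur_mult_vec[OF assms] diagonal_mult_axis[OF diag] i
          matrix_vector_mult_scaleR)
    ultimately show "is_eigenvalue C l" by (auto simp: is_eigenvalue_def)
  }
qed

lemma real_schur_lambda_max:
  assumes "real_schur C \<Phi> \<Lambda>"
  shows "lambda_max C = Max (range (\<lambda>i. \<Lambda> $ i $ i))"
  unfolding lambda_max_def real_schur_eigenvalue_iff[OF assms]
proof (rule Greatest_equality)
  have "Max (range (\<lambda>i. \<Lambda> $ i $ i)) \<in> range (\<lambda>i. \<Lambda> $ i $ i)"
    by (intro Max_in) auto
  then show "\<exists>i. Max (range (\<lambda>i. \<Lambda> $ i $ i)) = \<Lambda> $ i $ i"
    by (rule rangeE) (rule exI)
qed auto

lemma real_schur_diagonal_le_lambda_max: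
  "real_schur C \<Phi> \<Lambda> \<Longrightarrow> \<Lambda> $ i $ i \<le> lambda_max C"
  by (simp add: real_schur_lambda_max)

text \<open>The entry is the value of the quadratic form of \<open>C\<close> at column
  \<open>i\<close> of \<open>\<Phi>\<close>.\<close>

lemma real_schur_psd_diagonal_nonneg:
  assumes "real_schur C \<Phi> \<Lambda>" "sym_psd C"
  shows "0 \<le> \<Lambda> $ i $ i"
proof -
  have orth: "orthogonal_matrix \<Phi>" and diag: "is_diagonal \<Lambda>"
    using assms by (auto simp: real_schur_def)
  let ?v = "\<Phi> *v axis i 1"
  have "0 \<le> ?v \<bullet> (C *v ?v)"
    using assms(2) by (simp add: sym_psd_def)
  also have "\<dots> = (transpose \<Phi> *v (\<Phi> *v axis i 1)) \<bullet> (\<Lambda> *v axis i 1)"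
    by (simp add: real_schur_mult_vec[OF assms(1)] dot_lmul_matrix)
  also have "\<dots> = \<Lambda> $ i $ i"
    by (simp add: orthogonal_transpose_mult_vec[OF orth] diagonal_mult_axis[OF diag]
        inner_axis_axis del: transpose_matrix_vector)
  finally show ?thesis .
qed

text \<open>Otherwise the diagonal entries of \<open>\<Lambda>\<close>, which lie between 0 and
  \<open>lambda_max C\<close>, would all vanish, and \<open>C\<close> with them.\<close>

lemma real_schur_lambda_max_pos:
  assumes "real_schur C \<Phi> \<Lambda>" "sym_psd C" "C \<noteq> 0"
  shows "0 < lambda_max C"
proof (rule ccontr)
  assume "\<not> 0 < lambda_max C"
  then have "\<Lambda> $ i $ i = 0" for i
    using real_schur_diagonal_le_lambda_max[OF assms(1), of i]
      real_schur_psd_diagonal_nonneg[OF assms(1,2), of i] by linarith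
  then have "\<Lambda> = 0"
    using assms(1) by (metis (no_types) real_schur_def is_diagonal_def vec_eq_iff zero_index)
  then have "C = 0"
    using assms(1) by (simp add: real_schur_def)
  with assms(3) show False by contradiction
qed

section \<open>Complementing the variable and comparing the two maxima\<close>

lemma one_minus_feasible:
  fixes x :: "real^'n"
  assumes "x \<in> feasible t" "t + u = CARD('n)"
  shows "1 - x \<in> feasible u"
  using assms by (auto simp: feasible_def sum_subtractf simp flip: of_nat_add)

theorem theorem28:
  fixes C \<Phi> \<Lambda> A B :: "real^'n^'n" and s :: nat
  assumes "sym_psd C"
    and "0 < s" and "s < CARD('n)"
    and "s \<le> rank C"
    and "real_schur C \<Phi> \<Lambda>"
    and "A = \<Phi> ** diag_sqrt (mat 1 - (1 / lambda_max C) *\<^sub>R \<Lambda>)"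
    and "B = (1 / sqrt (lambda_max C)) *\<^sub>R diag_sqrt \<Lambda>"
  shows "natural_bound A B (CARD('n) - s) + ereal (real s * ln (lambda_max C)) = nlp_id_bound C s"
proof -
  define l where "l = lambda_max C"
  define c where "c = ereal (real s * ln l)"
  define D where "D = diag_sqrt (mat 1 - (1 / l) *\<^sub>R \<Lambda>)"
  define f where "f x = ldet (transpose A ** Diag x ** A + transpose B ** B)" for x
  define g where
    "g y = ldet (mat 1 + diag_sqrt (Diag y) ** ((1 / l) *\<^sub>R C - mat 1) ** diag_sqrt (Diag y))" for y
  \<comment> \<open>The zero matrix has rank 0, but \<open>0 < s\<close> and
    \<open>s \<le> rank C\<close>.\<close>
  have "C \<noteq> 0" using assms(2,4) by auto
  then have l: "0 < l"
    unfolding l_def by (rule real_schur_lambda_max_pos[OF assms(5,1)])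
  have orth: "\<Phi> ** transpose \<Phi> = mat 1" "transpose \<Phi> ** \<Phi> = mat 1"
    and diag: "is_diagonal \<Lambda>" and C: "C = \<Phi> ** \<Lambda> ** transpose \<Phi>"
    using assms(5) by (auto simp: real_schur_def orthogonal_matrix_def)
  have "is_diagonal (mat 1 - (1 / l) *\<^sub>R \<Lambda>)"
    using diag by (simp add: is_diagonal_def mat_def)
  \<comment> \<open>Every diagonal entry of \<open>\<Lambda>\<close> is at most \<open>l\<close>, so
    the square root defining \<open>D\<close> is a genuine one.\<close>
  moreover have "0 \<le> (mat 1 - (1 / l) *\<^sub>R \<Lambda>) $ i $ i" for i
    using l real_schur_diagonal_le_lambda_max[OF assms(5), of i]
    by (simp add: mat_def l_def)
  ultimately have DD: "D ** D = mat 1 - (1 / l) *\<^sub>R \<Lambda>"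
    unfolding D_def by (rule diag_sqrt_square)
  have "diag_sqrt \<Lambda> ** diag_sqrt \<Lambda> = \<Lambda>"
    using diag real_schur_psd_diagonal_nonneg[OF assms(5,1)] by (rule diag_sqrt_square)
  then have "transpose B ** B = (1 / l) *\<^sub>R \<Lambda>"
    using l by (simp add: assms(7) transpose_scalar transpose_diag_sqrt matrix_scalar_ac
        flip: l_def scalar_matrix_assoc)
  then have BB: "transpose B ** B = mat 1 - D ** D"
    by (simp add: DD)
  have "\<Phi> ** (D ** D) ** transpose \<Phi> = mat 1 - (1 / l) *\<^sub>R C"
    by (simp add: DD C matrix_diff_ldistrib matrix_diff_rdistrib orth matrix_scalar_ac
        flip: scalar_matrix_assoc)
  then have Cl: "(1 / l) *\<^sub>R C - mat 1 = - (\<Phi> ** D ** D ** transpose \<Phi>)"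
    by (simp add: matrix_mul_assoc)
  have fg: "f x = g (1 - x)" if "x \<in> feasible t" for x t
  proof -
    define S where "S = diag_sqrt (Diag (1 - x))"
    define P where "P = D ** transpose \<Phi> ** S"
    \<comment> \<open>\<open>Q\<close> is the transpose of \<open>P\<close>, since \<open>S\<close>
      and \<open>D\<close> are symmetric; as an explicit product it needs only associativity
      below.\<close>
    define Q where "Q = S ** \<Phi> ** D"
    have "S ** S = Diag (1 - x)"
      unfolding S_def using that
      by (intro diag_sqrt_square) (auto simp: feasible_def Diag_def is_diagonal_def)
    moreover have "Diag x = mat 1 - Diag (1 - x)"
      by (simp add: Diag_def mat_def vec_eq_iff)
    ultimately have Dx: "Diag x = mat 1 - S ** S" by simp
    have A: "A = \<Phi> ** D"
      unfolding assms(6) D_def l_def ..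
    then have At: "transpose A = D ** transpose \<Phi>"
      by (simp add: matrix_transpose_mul D_def transpose_diag_sqrt)
    have "transpose A ** A = D ** (transpose \<Phi> ** \<Phi>) ** D"
      unfolding At by (simp only: A matrix_mul_assoc)
    then have AA: "transpose A ** A = D ** D"
      by (simp add: orth)
    have "transpose A ** (S ** S) ** A = P ** Q"
      unfolding At P_def Q_def by (simp only: A matrix_mul_assoc)
    \<comment> \<open>Since \<open>Diag x = mat 1 - S ** S\<close>, the first summand is
      \<open>D ** D - P ** Q\<close>, and its \<open>D ** D\<close> cancels against the one in
      \<open>transpose B ** B\<close>.\<close>
    then have "transpose A ** Diag x ** A + transpose B ** B = mat 1 - P ** Q"
      by (simp add: BB Dx AA matrix_diff_ldistrib matrix_diff_rdistrib)
    moreover have "mat 1 + S ** ((1 / l) *\<^sub>R C - mat 1) ** S = mat 1 - Q ** P"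
    proof -
      have "S ** ((1 / l) *\<^sub>R C - mat 1) ** S = - (Q ** P)"
        unfolding Cl P_def Q_def
        by (simp add: matrix_mult_minus_left matrix_mult_minus_right matrix_mul_assoc)
      then show ?thesis by simp
    qed
    ultimately show ?thesis
      unfolding f_def g_def S_def[symmetric] by (simp add: ldet_def det_one_minus_mult_commute[of P Q])
  qed
  let ?N = "natural_bound A B (CARD('n) - s)"
  have N: "?N \<in> f ` feasible (CARD('n) - s)" "\<And>x. x \<in> feasible (CARD('n) - s) \<Longrightarrow> f x \<le> ?N"
    using natural_bound_attained[of "CARD('n) - s" A B] by (auto simp: f_def)
  have Z: "nlp_id_bound C s \<in> (\<lambda>y. g y + c) ` feasible s"
    "\<And>y. y \<in> feasible s \<Longrightarrow> g y + c \<le> nlp_id_bound C s"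
    using nlp_id_bound_attained[of s C] assms(3) by (auto simp: g_def c_def l_def)
  \<comment> \<open>A maximizer of the natural bound is carried by the complement to a feasible
    point of the other problem with the same value up to the shift \<open>c\<close>; the reverse
    inequality is symmetric.\<close>
  have "?N + c \<le> nlp_id_bound C s"
  proof -
    obtain x where x: "x \<in> feasible (CARD('n) - s)" "?N = f x" using N(1) by blast
    have "1 - x \<in> feasible s"
      using one_minus_feasible[OF x(1)] assms(3) by simp
    then show ?thesis using Z(2)[of "1 - x"] x fg by metis
  qed
  moreover have "nlp_id_bound C s \<le> ?N + c"
  proof -
    obtain y where y: "y \<in> feasible s" "nlp_id_bound C s = g y + c" using Z(1) by blast
    have x: "1 - y \<in> feasible (CARD('n) - s)"
      using one_minus_feasible[OF y(1)] assms(3) by simp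
    \<comment> \<open>This is \<open>fg\<close> at \<open>1 - y\<close>, whose complement is
      \<open>y\<close> again.\<close>
    have "g y = f (1 - y)"
      using fg[OF x] by simp
    then show ?thesis using N(2)[OF x] y by (simp add: add_right_mono)
  qed
  ultimately show ?thesis unfolding c_def l_def by (rule antisym)
qed

end
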